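(* Let ${\bf U}$ be a unipotent $\mathbb{Z}^p$-action on $\mathbb{Z}^q$. If $2\dim\mathrm{Fix}({\bf U})>q$, then ${\bf U}$ is liberated affine.
   Context: Here $p,q\ge1$. A $\mathbb{Z}^p$-action on $\mathbb{Z}^q$ is a homomorphism ${\bf U}:\mathbb{Z}^p\to\mathrm{Aut}(\mathbb{Z}^q)=GL(q,\mathbb{Z})$; it is unipotent if every ${\bf U}(\ell)$ is a unipotent automorphism. $\mathrm{Fix}({\bf U})=\{k\in\mathbb{Z}^q : {\bf U}(\ell)k=k \text{ for all } \ell\in\mathbb{Z}^p\}$, and $\dim\mathrm{Fix}({\bf U})$ is its rank as a free abelian group. Let $T^q=\mathbb{R}^q/\mathbb{Z}^q$ and let $\mathrm{Affine}(T^q)$ be the group of affine transformations ${\bf x}\mapsto B{\bf x}+{\bf a}$ of $T^q$, with $B\in GL(q,\mathbb{Z})$ and ${\bf a}\in T^q$. An affine $\mathbb{Z}^p$-action on $T^q$ is a homomorphism $\varphi:\mathbb{Z}^p\to\mathrm{Affine}(T^q)$; $\varphi_*$ denotes the induced $\mathbb{Z}^p$-action on $H_1(T^q,\mathbb{Z})=\mathbb{Z}^q$ (the linear part of $\varphi$). The action $\varphi$ is free if $\varphi(\ell)$ has no fixed point on $T^q$ for every $\ell\in\mathbb{Z}^p-\{0\}$. A $\mathbb{Z}^p$-action ${\bf U}$ on $\mathbb{Z}^q$ is liberated affine if there is a free affine $\mathbb{Z}^p$-action $\varphi$ on $T^q$ with $\varphi_*={\bf U}$. *)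

theory Defs
  imports "HOL-Analysis.Analysis" "HOL-Algebra.Group"
begin

section \<open>Integral lattices and their automorphisms\<close>

definition lattice_group :: "(int ^ 'p) monoid" where
  "lattice_group = \<lparr>carrier = UNIV, monoid.mult = (+), one = 0\<rparr>"

definition GL_int :: "(int ^ 'q ^ 'q) monoid" where
  "GL_int = \<lparr>carrier = {A. invertible A}, monoid.mult = (**), one = mat 1\<rparr>"

lemma group_lattice_group: "group (lattice_group :: (int ^ 'p) monoid)"
  unfolding lattice_group_def
proof (rule groupI, goal_cases)
  case (5 x)
  show ?case by (auto intro: exI[of _ "- x"])
qed (auto simp: algebra_simps)

lemma group_GL_int: "group (GL_int :: (int ^ 'q ^ 'q) monoid)"
  unfolding GL_int_def
proof (rule groupI, goal_cases)
  case (5 A)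
  then obtain B where "A ** B = mat 1" "B ** A = mat 1"
    by (auto simp: invertible_def)
  then show ?case by (auto simp: invertible_def)
next
  case 2
  then show ?case by (auto simp: invertible_def)
qed (auto simp: matrix_mul_assoc invertible_mult)

definition linear_action :: "(int ^ 'p \<Rightarrow> int ^ 'q ^ 'q) \<Rightarrow> bool" where
  "linear_action U \<longleftrightarrow> U \<in> hom lattice_group GL_int"

text \<open>
  The type of matrices carries the componentwise product, so \<open>^\<close> is not the matrix power;
  \<open>((**) N ^^ n) (mat 1)\<close> is the \<open>n\<close>-fold matrix product of \<open>N\<close>.
\<close>
definition unipotent :: "int ^ 'q ^ 'q \<Rightarrow> bool" where
  "unipotent A \<longleftrightarrow> (\<exists>n. ((**) (A - mat 1) ^^ n) (mat 1) = 0)"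

definition unipotent_action :: "(int ^ 'p \<Rightarrow> int ^ 'q ^ 'q) \<Rightarrow> bool" where
  "unipotent_action U \<longleftrightarrow> linear_action U \<and> (\<forall>l. unipotent (U l))"

definition Fix :: "(int ^ 'p \<Rightarrow> int ^ 'q ^ 'q) \<Rightarrow> (int ^ 'q) set" where
  "Fix U = {k. \<forall>l. U l *v k = k}"

global_interpretation int_vec: module "(*s) :: int \<Rightarrow> int ^ 'q \<Rightarrow> int ^ 'q"
  by unfold_locales (simp_all add: vec_eq_iff algebra_simps)

text \<open>
  The rank of a subgroup of the lattice: the cardinality of a \<open>\<int>\<close>-basis. Every subgroup of
  \<open>\<int>\<^sup>q\<close> is free and all its bases have the same cardinality, so the choice is immaterial.
\<close>
definition free_rank :: "(int ^ 'q) set \<Rightarrow> nat" where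
  "free_rank G = card (SOME B. int_vec.independent B \<and> int_vec.span B = G)"


section \<open>The torus and its affine transformations\<close>

definition torus_rel :: "real ^ 'q \<Rightarrow> real ^ 'q \<Rightarrow> bool" where
  "torus_rel x y \<longleftrightarrow> (\<forall>i. x $ i - y $ i \<in> \<int>)"

lemma equivp_torus_rel: "equivp torus_rel"
proof (rule equivpI)
  show "reflp torus_rel"
    by (simp add: reflp_def torus_rel_def)
  show "symp torus_rel"
  proof (rule sympI)
    fix x y :: "real ^ 'q"
    assume "torus_rel x y"
    then show "torus_rel y x"
      unfolding torus_rel_def using Ints_minus by fastforce
  qed
  show "transp torus_rel"
  proof (rule transpI)
    fix x y z :: "real ^ 'q"
    assume xy: "torus_rel x y" and yz: "torus_rel y z"
    show "torus_rel x z"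
      unfolding torus_rel_def
    proof
      fix i
      have "(x $ i - y $ i) + (y $ i - z $ i) \<in> \<int>"
        using xy yz by (intro Ints_add) (auto simp: torus_rel_def)
      then show "x $ i - z $ i \<in> \<int>" by simp
    qed
  qed
qed

quotient_type 'q torus = "real ^ 'q" / torus_rel
  by (rule equivp_torus_rel)

instantiation torus :: (finite) ab_group_add
begin

lift_definition zero_torus :: "'a torus" is 0 .

lift_definition plus_torus :: "'a torus \<Rightarrow> 'a torus \<Rightarrow> 'a torus" is "(+)"
  unfolding torus_rel_def by (simp add: add_diff_add)

lift_definition uminus_torus :: "'a torus \<Rightarrow> 'a torus" is uminus
  unfolding torus_rel_def using Ints_minus by fastforce

lift_definition minus_torus :: "'a torus \<Rightarrow> 'a torus \<Rightarrow> 'a torus" is "(-)"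
proof -
  fix x x' y y' :: "real ^ 'a"
  assume "torus_rel x x'" "torus_rel y y'"
  then have "(x $ i - x' $ i) - (y $ i - y' $ i) \<in> \<int>" for i
    by (simp only: torus_rel_def Ints_diff)
  then show "torus_rel (x - y) (x' - y')"
    by (simp add: torus_rel_def algebra_simps)
qed

instance
  by standard (transfer; simp add: torus_rel_def)+

end

lift_definition torus_linear :: "int ^ 'q ^ 'q \<Rightarrow> 'q torus \<Rightarrow> 'q torus" is
  "\<lambda>B x. map_matrix real_of_int B *v x"
proof -
  fix B :: "int ^ 'q ^ 'q" and x y :: "real ^ 'q"
  assume "torus_rel x y"
  then have "(\<Sum>j\<in>UNIV. real_of_int (B $ i $ j) * (x $ j - y $ j)) \<in> \<int>" for i
    by (auto simp: torus_rel_def intro!: Ints_sum)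
  then show "torus_rel (map_matrix real_of_int B *v x) (map_matrix real_of_int B *v y)"
    by (simp add: torus_rel_def matrix_vector_mult_def sum_subtractf algebra_simps)
qed

definition torus_affine :: "int ^ 'q ^ 'q \<Rightarrow> 'q torus \<Rightarrow> 'q torus \<Rightarrow> 'q torus" where
  "torus_affine B a = (\<lambda>x. torus_linear B x + a)"

definition affine_group :: "('q::finite torus \<Rightarrow> 'q torus) monoid" where
  "affine_group =
    \<lparr>carrier = {f. \<exists>B a. invertible B \<and> f = torus_affine B a}, monoid.mult = (\<circ>), one = id\<rparr>"

lemma torus_linear_add: "torus_linear B (x + y) = torus_linear B x + torus_linear B y"
  by transfer (simp add: torus_rel_def matrix_vector_right_distrib)

lemma torus_linear_mat_1: "torus_linear (mat 1) x = x"
proof transfer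
  fix x :: "real ^ 'a"
  have "map_matrix real_of_int (mat 1) = (mat 1 :: real ^ 'a ^ 'a)"
    by (simp add: vec_eq_iff mat_def)
  then show "torus_rel (map_matrix real_of_int (mat 1) *v x) x"
    by (simp add: torus_rel_def)
qed

lemma torus_linear_mult: "torus_linear (A ** B) x = torus_linear A (torus_linear B x)"
proof transfer
  fix A B :: "int ^ 'a ^ 'a" and x :: "real ^ 'a"
  have "map_matrix real_of_int (A ** B) = map_matrix real_of_int A ** map_matrix real_of_int B"
    by (simp add: vec_eq_iff matrix_matrix_mult_def)
  then show "torus_rel (map_matrix real_of_int (A ** B) *v x)
      (map_matrix real_of_int A *v (map_matrix real_of_int B *v x))"
    by (simp add: torus_rel_def matrix_vector_mul_assoc)
qed

lemma torus_affine_comp: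
  "torus_affine A a \<circ> torus_affine B b = torus_affine (A ** B) (torus_linear A b + a)"
  by (simp add: torus_affine_def fun_eq_iff torus_linear_add torus_linear_mult add.assoc)

lemma torus_affine_id: "torus_affine (mat 1) 0 = id"
  by (simp add: torus_affine_def fun_eq_iff torus_linear_mat_1)

lemma group_affine_group: "group (affine_group :: ('q::finite torus \<Rightarrow> 'q torus) monoid)"
  unfolding affine_group_def
proof (rule groupI, goal_cases)
  case (1 f g)
  then show ?case
    by (auto simp: torus_affine_comp) (blast intro: invertible_mult)
next
  case 2
  have "invertible (mat 1 :: int ^ 'q ^ 'q)"
    by (auto simp: invertible_def)
  then show ?case
    by (auto simp: torus_affine_id [symmetric])
next
  case (5 f)
  then obtain A a where A: "invertible A" "f = torus_affine A a"
    by auto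
  then obtain B where B: "A ** B = mat 1" "B ** A = mat 1"
    by (auto simp: invertible_def)
  have "torus_affine B (- torus_linear B a) \<circ> f = id"
    using A B by (simp add: torus_affine_comp torus_affine_id)
  moreover have "invertible B"
    using B by (auto simp: invertible_def)
  ultimately show ?case by auto
qed (auto simp: o_assoc)

lemma torus_affine_linear_unique:
  assumes "torus_affine B a = torus_affine C b"
  shows "B = C"
proof -
  have eq: "torus_linear B x + a = torus_linear C x + b" for x
    using assms by (simp add: torus_affine_def fun_eq_iff)
  have zero: "torus_linear D 0 = 0" for D :: "int ^ 'a ^ 'a"
    using torus_linear_add[of D 0 0] by simp
  have lin: "torus_linear B x = torus_linear C x" for x
    using eq[of x] eq[of 0] by (simp add: zero)
  have int: "(map_matrix real_of_int B *v x) $ i - (map_matrix real_of_int C *v x) $ i \<in> \<int>"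
    for x i
    using lin[of "abs_torus x"]
    by (simp add: torus_linear.abs_eq torus.abs_eq_iff torus_rel_def)
  have "B $ i $ j = C $ i $ j" for i j
  proof (rule ccontr)
    assume ne: "B $ i $ j \<noteq> C $ i $ j"
    define d where "d = real_of_int (B $ i $ j) - real_of_int (C $ i $ j)"
    have d: "d \<noteq> 0" using ne by (simp add: d_def)
    have "(map_matrix real_of_int B *v axis j (1 / (2 * d))) $ i
        - (map_matrix real_of_int C *v axis j (1 / (2 * d))) $ i = d * (1 / (2 * d))"
      by (simp add: matrix_vector_mult_def axis_def if_distrib d_def diff_divide_distrib
          cong: if_cong)
    also have "\<dots> = 1 / 2" using d by simp
    finally have "(1 / 2 :: real) \<in> \<int>" using int by metis
    then obtain n :: int where "1 / 2 = real_of_int n" by (auto elim: Ints_cases)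
    then have "real_of_int (2 * n) = real_of_int 1" by simp
    then have "2 * n = 1" by (simp only: of_int_eq_iff)
    then show False by presburger
  qed
  then show ?thesis by (simp add: vec_eq_iff)
qed

text \<open>
  Under the identification of the first homology group of the torus with \<open>\<int>\<^sup>q\<close>, an affine
  transformation acts by its linear part.
\<close>
definition linear_part :: "('q::finite torus \<Rightarrow> 'q torus) \<Rightarrow> int ^ 'q ^ 'q" where
  "linear_part f = (THE B. \<exists>a. f = torus_affine B a)"

lemma linear_part_torus_affine: "linear_part (torus_affine B a) = B"
  unfolding linear_part_def by (blast dest: torus_affine_linear_unique)


section \<open>Affine actions\<close>

definition affine_action :: "(int ^ 'p \<Rightarrow> 'q::finite torus \<Rightarrow> 'q torus) \<Rightarrow> bool" where
  "affine_action \<phi> \<longleftrightarrow> \<phi> \<in> hom lattice_group affine_group"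

definition induced_action :: "(int ^ 'p \<Rightarrow> 'q torus \<Rightarrow> 'q torus) \<Rightarrow> int ^ 'p \<Rightarrow> int ^ 'q ^ 'q" where
  "induced_action \<phi> = (\<lambda>l. linear_part (\<phi> l))"

definition free_action :: "(int ^ 'p \<Rightarrow> 'q::finite torus \<Rightarrow> 'q torus) \<Rightarrow> bool" where
  "free_action \<phi> \<longleftrightarrow> (\<forall>l. l \<noteq> 0 \<longrightarrow> (\<forall>x. \<phi> l x \<noteq> x))"

definition liberated_affine :: "(int ^ 'p \<Rightarrow> int ^ 'q ^ 'q) \<Rightarrow> bool" where
  "liberated_affine U \<longleftrightarrow>
    (\<exists>\<phi> :: int ^ 'p \<Rightarrow> 'q torus \<Rightarrow> 'q torus.
      affine_action \<phi> \<and> free_action \<phi> \<and> induced_action \<phi> = U)"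

end

theory Submission
  imports Defs
begin

text \<open>
  Let the translation parts be a generic homomorphism \<open>v\<close> from the acting group to
  \<open>Fix U \<otimes> \<real>\<close>; this is a cocycle because \<open>U\<close> acts trivially there. For \<open>l \<noteq> 0\<close> the
  image of \<open>U l - 1\<close> has dimension at most \<open>q - dim Fix U < dim Fix U\<close>, hence some rational
  functional kills this image but not \<open>Fix U\<close>. At a fixed point of the affine map it would take a
  rational value on \<open>v l\<close>, which is excluded by choosing the coordinates of \<open>v\<close> linearly
  independent, together with 1, over the rationals.
\<close>

section \<open>Subgroups of the lattice are free\<close>

text \<open>The \<open>i\<close>-th coordinates of \<open>G\<close> form an ideal of the integers. A
  member of \<open>G\<close> with the least positive coordinate generates it, by division with
  remainder.\<close>

lemma int_subspace_coordinate_generator: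
  assumes G: "int_vec.subspace (G :: (int ^ 'n) set)"
  shows "\<exists>g\<in>G. \<forall>x\<in>G. g $ i dvd x $ i"
proof (cases "\<forall>x\<in>G. x $ i = 0")
  case True
  then show ?thesis using assms int_vec.subspace_0 by (intro bexI[of _ 0]) auto
next
  case False
  define P where "P n \<longleftrightarrow> n > 0 \<and> (\<exists>g\<in>G. g $ i = int n)" for n
  from False obtain x where x: "x \<in> G" "x $ i \<noteq> 0" by blast
  have "P (nat \<bar>x $ i\<bar>)"
  proof (cases "x $ i > 0")
    case True
    then show ?thesis using x by (auto simp: P_def)
  next
    case False
    have "- x \<in> G" using G x by (rule_tac int_vec.subspace_neg)
    then show ?thesis using x False by (auto simp: P_def intro!: bexI[of _ "- x"])
  qed
  then have L: "P (Least P)" by (rule LeastI)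
  then obtain g where g: "g \<in> G" "g $ i = int (Least P)" "Least P > 0" by (auto simp: P_def)
  have "g $ i dvd y $ i" if y: "y \<in> G" for y
  proof (rule ccontr)
    assume nd: "\<not> g $ i dvd y $ i"
    \<comment> \<open>The coordinate of \<open>z\<close> is the remainder: positive by
      non-divisibility, yet below the minimum.\<close>
    define z where "z = y - (y $ i div g $ i) *s g"
    have "z \<in> G" using G y g by (auto simp: z_def intro!: int_vec.subspace_diff int_vec.subspace_scale)
    moreover have z: "z $ i = y $ i mod g $ i"
      by (simp add: z_def minus_div_mult_eq_mod)
    moreover have "z $ i > 0"
    proof -
      have "0 \<le> y $ i mod g $ i" using g by simp
      moreover have "y $ i mod g $ i \<noteq> 0" using nd by (simp add: mod_eq_0_iff_dvd)
      ultimately show ?thesis unfolding z by linarith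
    qed
    ultimately have "P (nat (z $ i))" unfolding P_def by (metis int_nat_eq less_imp_le zero_less_nat_eq)
    then have "Least P \<le> nat (z $ i)" by (rule Least_le)
    moreover have "z $ i < g $ i" using g z by simp
    ultimately show False using g by linarith
  qed
  then show ?thesis using g by blast
qed

text \<open>Induction on the set \<open>S\<close> of coordinates that may be nonzero. The members of
  \<open>G\<close> vanishing at \<open>i\<close> form a subgroup \<open>H\<close> with a basis by
  induction, and one \<open>g\<close> generating the ideal of \<open>i\<close>-th coordinates
  extends it to a basis of \<open>G\<close>.\<close>

lemma int_basis_exists_supported:
  assumes "finite S"
  shows "int_vec.subspace (G :: (int ^ 'n) set) \<Longrightarrow> (\<And>x j. x \<in> G \<Longrightarrow> j \<notin> S \<Longrightarrow> x $ j = 0) \<Longrightarrow>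
    \<exists>B. finite B \<and> int_vec.independent B \<and> int_vec.span B = G"
  using assms
proof (induction S arbitrary: G rule: finite_induct)
  case empty
  then have "G = {0}" using int_vec.subspace_0 by (auto simp: vec_eq_iff)
  then show ?case by (intro exI[of _ "{}"]) (auto simp: int_vec.independent_empty)
next
  case (insert i S)
  define H where "H = {x \<in> G. x $ i = 0}"
  have HG: "int_vec.subspace H"
    using insert.prems(1) by (auto simp: H_def int_vec.subspace_def)
  have "x $ j = 0" if "x \<in> H" "j \<notin> S" for x j
    using that insert.prems(2)[of x j] by (cases "j = i") (auto simp: H_def)
  from insert.IH[OF HG this] obtain B
    where B: "finite B" "int_vec.independent B" "int_vec.span B = H" by blast
  from int_subspace_coordinate_generator[OF insert.prems(1), of i] obtain g
    where g: "g \<in> G" "\<And>x. x \<in> G \<Longrightarrow> g $ i dvd x $ i" by blast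
  show ?case
  proof (cases "g $ i = 0")
    case True
    then have "H = G" using g(2) by (fastforce simp: H_def)
    then show ?thesis using B by blast
  next
    case False
    have BH: "B \<subseteq> H" using B(3) int_vec.span_superset by blast
    have gB: "g \<notin> B" using BH False by (auto simp: H_def)
    have "int_vec.independent (insert g B)"
    proof
      assume "int_vec.dependent (insert g B)"
      then obtain u where u: "\<exists>v\<in>insert g B. u v \<noteq> 0" "(\<Sum>v\<in>insert g B. u v *s v) = 0"
        using B(1) by (auto simp: int_vec.dependent_finite)
      \<comment> \<open>Coordinate \<open>i\<close> vanishes on \<open>H\<close>, so reading the
        relation there isolates \<open>u g\<close>.\<close>
      have "(\<Sum>v\<in>B. u v *s v) \<in> H"
        using HG BH by (intro int_vec.subspace_sum int_vec.subspace_scale) auto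
      then have coord: "(\<Sum>v\<in>B. u v *s v) $ i = 0" by (simp only: H_def mem_Collect_eq)
      have eq: "u g *s g + (\<Sum>v\<in>B. u v *s v) = 0" using u(2) gB B(1) by simp
      have "u g * g $ i = 0"
        using arg_cong[OF eq, of "\<lambda>x. x $ i"]
        by (simp only: vector_add_component vector_smult_component zero_index coord add_0_right)
      then have ug: "u g = 0" using False by simp
      then have "(\<Sum>v\<in>B. u v *s v) = 0" using eq by simp
      then have "\<forall>v\<in>B. u v = 0" using int_vec.dependent_finite[OF B(1)] B(2) by blast
      with ug u(1) show False by auto
    qed
    moreover have "int_vec.span (insert g B) = G"
    proof
      show "int_vec.span (insert g B) \<subseteq> G"
        using g BH insert.prems(1) by (intro int_vec.span_minimal) (auto simp: H_def)
      show "G \<subseteq> int_vec.span (insert g B)"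
      proof
        fix x assume x: "x \<in> G"
        \<comment> \<open>Divisibility makes the division exact, so this difference has coordinate 0
          at \<open>i\<close>.\<close>
        have "x - (x $ i div g $ i) *s g \<in> H"
          using x g insert.prems(1)
          by (auto simp: H_def intro!: int_vec.subspace_diff int_vec.subspace_scale)
        then show "x \<in> int_vec.span (insert g B)"
          using B(3) by (auto simp: int_vec.span_breakdown_eq)
      qed
    qed
    ultimately show ?thesis using B(1) by blast
  qed
qed

lemma int_basis_exists:
  assumes "int_vec.subspace (G :: (int ^ 'n) set)"
  shows "\<exists>B. int_vec.independent B \<and> int_vec.span B = G"
  using int_basis_exists_supported[OF finite_class.finite_UNIV assms] by blast

text \<open>Existence of a basis ensures that the choice inside \<open>free_rank\<close> is itself
  one; that chosen basis is returned.\<close>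

lemma free_rank_basis:
  assumes "int_vec.subspace (G :: (int ^ 'n) set)"
  obtains B where "int_vec.independent B" "int_vec.span B = G" "card B = free_rank G"
  using someI_ex[OF int_basis_exists[OF assms]] unfolding free_rank_def by blast


section \<open>Rational functionals\<close>

text \<open>The target ring stays generic: the rationals serve for linear algebra over a field, the
  reals for translations of the torus.\<close>

definition of_int_vec :: "int ^ 'n \<Rightarrow> 'a::ring_1 ^ 'n" where
  "of_int_vec v = (\<chi> i. of_int (v $ i))"

lemma of_int_vec_nth [simp]: "of_int_vec v $ i = of_int (v $ i)"
  by (simp add: of_int_vec_def)

lemma inj_of_int_vec: "inj (of_int_vec :: int ^ 'n \<Rightarrow> 'a::ring_char_0 ^ 'n)"
  by (auto simp: inj_def vec_eq_iff)

lemma of_int_vec_mult: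
  "map_matrix of_int A *v of_int_vec v = (of_int_vec (A *v v) :: 'a::ring_1 ^ 'n)"
  by (simp add: vec_eq_iff matrix_vector_mult_def)

lemma common_denominator:
  assumes "finite B"
  shows "\<exists>(d::int) m. d \<noteq> 0 \<and> (\<forall>b\<in>B. of_int d * u b = (of_int (m b) :: rat))"
  using assms
proof (induction B rule: finite_induct)
  case empty
  show ?case by (intro exI[of _ 1]) auto
next
  case (insert b B)
  then obtain d m where dm: "(d::int) \<noteq> 0" "\<And>b. b \<in> B \<Longrightarrow> of_int d * u b = (of_int (m b) :: rat)"
    by blast
  obtain x y where xy: "u b = Fract x y" "y > 0" by (cases "u b") auto
  have ub: "of_int y * u b = of_int x"
    using xy by (simp add: Fract_of_int_quotient)
  show ?case
  proof (intro exI conjI ballI)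
    show "d * y \<noteq> 0" using dm xy by simp
    fix a assume "a \<in> insert b B"
    then show "of_int (d * y) * u a = of_int ((\<lambda>a. if a = b then d * x else y * m a) a)"
      using dm(2)[of a] ub insert.hyps by (auto simp: mult.assoc mult.left_commute)
  qed
qed

text \<open>Multiplying a rational dependence by a common denominator yields an integral one with
  the same nonzero coefficients.\<close>

lemma independent_of_int_vec:
  assumes B: "int_vec.independent B" "finite B"
  shows "vec.independent (of_int_vec ` B :: (rat ^ 'n) set)"
proof
  let ?f = "of_int_vec :: int ^ 'n \<Rightarrow> rat ^ 'n"
  have inj: "inj_on ?f B" using inj_of_int_vec by (rule inj_on_subset) simp
  assume "vec.dependent (?f ` B)"
  then obtain u where u: "\<exists>v\<in>?f ` B. u v \<noteq> 0" "(\<Sum>v\<in>?f ` B. u v *s v) = 0"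
    using B(2) by (auto simp: vec.dependent_finite)
  have sum: "(\<Sum>b\<in>B. u (?f b) *s ?f b) = 0"
    using u(2) by (simp add: sum.reindex[OF inj])
  obtain d :: int and m where dm: "d \<noteq> 0" "\<And>b. b \<in> B \<Longrightarrow> of_int d * u (?f b) = of_int (m b)"
    using common_denominator[OF B(2), of "\<lambda>b. u (?f b)"] by blast
  have "(\<Sum>b\<in>B. m b *s b) $ i = 0" for i
  proof -
    have "of_int ((\<Sum>b\<in>B. m b *s b) $ i) = (\<Sum>b\<in>B. of_int (m b) * of_int (b $ i) :: rat)"
      by simp
    also have "\<dots> = (\<Sum>b\<in>B. of_int d * (u (?f b) *s ?f b) $ i)"
      by (intro sum.cong refl) (simp flip: dm(2))
    also have "\<dots> = of_int d * (\<Sum>b\<in>B. u (?f b) *s ?f b) $ i"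
      by (simp add: sum_distrib_left)
    also have "\<dots> = 0" by (simp add: sum)
    finally show ?thesis by (simp only: of_int_eq_0_iff)
  qed
  then have "(\<Sum>b\<in>B. m b *s b) = 0" by (simp add: vec_eq_iff)
  then have "\<forall>b\<in>B. m b = 0" using int_vec.dependent_finite[OF B(2)] B(1) by blast
  then have "\<forall>b\<in>B. u (?f b) = 0" using dm by fastforce
  with u(1) show False by auto
qed

text \<open>Half of rank-nullity: extend \<open>B\<close> to a basis \<open>C\<close> of the whole
  space; the images of \<open>C - B\<close> alone span the range.\<close>

lemma dim_range_le_of_kernel:
  fixes N :: "'a::field ^ 'n ^ 'n"
  assumes B: "vec.independent B" and ker: "\<And>b. b \<in> B \<Longrightarrow> N *v b = 0"
  shows "vec.dim (range ((*v) N)) + card B \<le> CARD('n)"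
proof -
  define C where "C = vec.extend_basis B"
  have C: "B \<subseteq> C" "vec.independent C" "vec.span C = UNIV"
    using B by (simp_all add: C_def vec.extend_basis_superset vec.independent_extend_basis)
  have fin: "finite C" using C(2) by (rule vec.finiteI_independent)
  have card: "card C = CARD('n)"
    using vec.dim_span_eq_card_independent[OF C(2)] vec_dim_card by (metis C(3))
  have "range ((*v) N) = vec.span ((*v) N ` C)"
    by (simp only: vec.span_image C(3))
  also have "\<dots> \<subseteq> vec.span ((*v) N ` (C - B))"
  proof (rule vec.span_minimal)
    show "(*v) N ` C \<subseteq> vec.span ((*v) N ` (C - B))"
    proof
      fix y assume "y \<in> (*v) N ` C"
      then obtain x where "x \<in> C" "y = N *v x" by blast
      then show "y \<in> vec.span ((*v) N ` (C - B))"
        using ker by (cases "x \<in> B") (auto intro: vec.span_base vec.span_zero)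
    qed
  qed simp
  finally have "vec.dim (range ((*v) N)) \<le> card ((*v) N ` (C - B))"
    using fin by (intro vec.dim_le_card) auto
  also have "\<dots> \<le> card (C - B)" using fin by (intro card_image_le) auto
  also have "\<dots> = card C - card B" using C(1) fin by (meson card_Diff_subset finite_subset)
  finally show ?thesis using card card_mono[OF fin C(1)] by linarith
qed

text \<open>A linear map that kills the range of \<open>N\<close> but fixes \<open>b\<close> has a
  matrix row that separates the two.\<close>

lemma separating_row:
  fixes N :: "'a::field ^ 'n ^ 'n"
  assumes "b \<notin> range ((*v) N)"
  obtains c :: "'a ^ 'n" where "c v* N = 0" "(\<Sum>i\<in>UNIV. c $ i * b $ i) \<noteq> 0"
proof -
  let ?W = "range ((*v) N)"
  have sub: "vec.subspace ?W" by (intro vec.subspace_image vec.subspace_UNIV)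
  obtain C where C: "C \<subseteq> ?W" "vec.independent C" "?W \<subseteq> vec.span C"
    by (rule vec.basis_exists[of ?W])
  have bC: "b \<notin> vec.span C" using assms C(1) sub vec.span_minimal by blast
  then have "vec.independent (insert b C)" using C(2) by (rule vec.independent_insertI)
  then obtain g where g: "Vector_Spaces.linear (*s) (*s) g"
      "\<forall>x\<in>insert b C. g x = (if x = b then b else 0)"
    using vec.linear_independent_extend[where f = "\<lambda>x. if x = b then b else 0"] by blast
  interpret g: Vector_Spaces.linear "(*s)" "(*s)" g by (rule g(1))
  have gC: "g x = 0" if "x \<in> C" for x
    using bspec[OF g(2), of x] vec.span_base[OF that] that bC by auto
  have gW: "g x = 0" if "x \<in> ?W" for x
    using g.eq_0_on_span[OF gC] C(3) that by blast
  have mg: "matrix g *v x = g x" for x using matrix_works[OF g(1)] .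
  have b0: "b \<noteq> 0" using bC vec.span_zero by metis
  then obtain k where k: "b $ k \<noteq> 0" by (auto simp: vec_eq_iff)
  \<comment> \<open>Pairing with this row computes the \<open>k\<close>-th coordinate of
    \<open>g\<close>, which at \<open>b\<close> is \<open>b $ k\<close>, nonzero by the choice of
    \<open>k\<close>.\<close>
  define c where "c = matrix g $ k"
  have cx: "(\<Sum>i\<in>UNIV. c $ i * x $ i) = g x $ k" for x
    using arg_cong[OF mg[of x], of "\<lambda>v. v $ k"]
    by (simp only: c_def matrix_vector_mult_def vec_lambda_beta)
  show ?thesis
  proof
    show "(\<Sum>i\<in>UNIV. c $ i * b $ i) \<noteq> 0" using k g(2) by (simp add: cx)
    have "(\<Sum>i\<in>UNIV. N $ i $ j * c $ i) = 0" for j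
    proof -
      \<comment> \<open>Testing on standard basis vectors gives \<open>c v* N = 0\<close> column by
        column.\<close>
      have "g (N *v axis j 1) = 0" by (rule gW) simp
      then have "(\<Sum>i\<in>UNIV. c $ i * (N *v axis j 1) $ i) = 0" by (simp add: cx)
      moreover have "(N *v axis j 1) $ i = N $ i $ j" for i
        by (simp add: matrix_vector_mult_def axis_def if_distrib cong: if_cong)
      ultimately show ?thesis by (simp add: mult.commute)
    qed
    then show "c v* N = 0" by (simp add: vec_eq_iff vector_matrix_mult_def mult.commute)
  qed
qed

text \<open>The rank of \<open>N\<close> is at most \<open>CARD('n) - card B < card B\<close>, so
  the independent set \<open>B\<close> cannot lie in the range over the rationals; a member outside
  it is separated by a row.\<close>

lemma rational_functional:
  fixes N :: "int ^ 'n ^ 'n"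
  assumes B: "int_vec.independent B" and ker: "\<And>b. b \<in> B \<Longrightarrow> N *v b = 0"
    and card: "CARD('n) < 2 * card B"
  obtains c :: "rat ^ 'n" where "\<And>j. (\<Sum>i\<in>UNIV. c $ i * of_int (N $ i $ j)) = 0"
    "\<exists>b\<in>B. (\<Sum>i\<in>UNIV. c $ i * of_int (b $ i)) \<noteq> 0"
proof -
  let ?N = "map_matrix of_int N :: rat ^ 'n ^ 'n"
  let ?B = "of_int_vec ` B :: (rat ^ 'n) set"
  \<comment> \<open>Infinite sets have \<open>card\<close> 0, so the strict bound forces
    finiteness.\<close>
  have fin: "finite B" using card by (auto intro: card_ge_0_finite)
  have ind: "vec.independent ?B" using B fin by (rule independent_of_int_vec)
  have "card ?B = card B" by (metis card_image inj_of_int_vec inj_on_subset subset_UNIV)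
  moreover have "?N *v x = 0" if "x \<in> ?B" for x
    using that ker by (auto simp: of_int_vec_mult vec_eq_iff)
  ultimately have "vec.dim (range ((*v) ?N)) < card ?B"
    using dim_range_le_of_kernel[OF ind, of ?N] card by simp
  then have "\<not> ?B \<subseteq> range ((*v) ?N)"
    using vec.independent_card_le_dim[OF _ ind] by (metis not_less)
  then obtain b where b: "b \<in> B" "of_int_vec b \<notin> range ((*v) ?N)" by blast
  obtain c where c: "c v* ?N = 0" "(\<Sum>i\<in>UNIV. c $ i * of_int_vec b $ i) \<noteq> 0"
    using separating_row[OF b(2)] .
  show ?thesis
  proof
    show "(\<Sum>i\<in>UNIV. c $ i * of_int (N $ i $ j)) = 0" for j
      using c(1) by (simp add: vec_eq_iff vector_matrix_mult_def mult.commute)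
    show "\<exists>b\<in>B. (\<Sum>i\<in>UNIV. c $ i * of_int (b $ i)) \<noteq> 0" using b c by auto
  qed
qed


section \<open>Rationally independent families\<close>

text \<open>Countability leaves room to pick a real outside the rational span of finitely many given
  ones.\<close>

lemma countable_rat_combinations:
  fixes \<alpha> :: "'i \<Rightarrow> real"
  assumes "finite I"
  shows "countable (range (\<lambda>c. \<Sum>i\<in>I. of_rat (c i) * \<alpha> i))"
  using assms
proof (induction I rule: finite_induct)
  case (insert k I)
  let ?S = "range (\<lambda>c. \<Sum>i\<in>I. of_rat (c i) * \<alpha> i)"
  have "range (\<lambda>c. \<Sum>i\<in>insert k I. of_rat (c i) * \<alpha> i)
      \<subseteq> (\<lambda>(r, s). of_rat r * \<alpha> k + s) ` (UNIV \<times> ?S)"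
    using insert.hyps by (auto simp: image_iff)
  moreover have "countable ((\<lambda>(r, s). of_rat r * \<alpha> k + s) ` ((UNIV :: rat set) \<times> ?S))"
    by (rule countable_image, rule countable_SIGMA) (simp, rule insert.IH)
  ultimately show ?case by (rule countable_subset)
qed simp

text \<open>Asking for a value in \<rat> instead of 0 encodes independence together with 1. The
  family grows by one real at a time, taken outside the countable rational span of 1 and its
  predecessors.\<close>

lemma rationally_independent_family:
  assumes "finite I"
  shows "\<exists>\<alpha> :: 'i \<Rightarrow> real. \<forall>c. (\<Sum>i\<in>I. of_rat (c i) * \<alpha> i) \<in> \<rat> \<longrightarrow> (\<forall>i\<in>I. c i = 0)"
  using assms
proof (induction I rule: finite_induct)
  case (insert k I)
  then obtain \<alpha> :: "'i \<Rightarrow> real"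
    where \<alpha>: "\<And>c. (\<Sum>i\<in>I. of_rat (c i) * \<alpha> i) \<in> \<rat> \<Longrightarrow> \<forall>i\<in>I. c i = 0" by blast
  let ?S = "range (\<lambda>c. \<Sum>i\<in>I. of_rat (c i) * \<alpha> i)"
  let ?C = "(\<lambda>(r, s). r + s) ` (\<rat> \<times> ?S)"
  have "countable ?C"
    by (intro countable_image[OF countable_SIGMA] countable_rat countable_rat_combinations insert.hyps)
  then have "?C \<noteq> UNIV" using uncountable_UNIV_real by (intro notI) (simp only:)
  then obtain x where x: "x \<notin> ?C" by blast
  define \<beta> where "\<beta> = \<alpha>(k := x)"
  have "\<forall>i\<in>insert k I. c i = 0" if c: "(\<Sum>i\<in>insert k I. of_rat (c i) * \<beta> i) \<in> \<rat>" for c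
  proof -
    let ?s = "\<Sum>i\<in>I. of_rat (c i) * \<alpha> i"
    have "(\<Sum>i\<in>I. of_rat (c i) * \<beta> i) = ?s"
      using insert.hyps by (intro sum.cong) (auto simp: \<beta>_def)
    then have eq: "of_rat (c k) * x + ?s \<in> \<rat>"
      using c insert.hyps by (simp add: \<beta>_def)
    have "c k = 0"
    proof (rule ccontr)
      assume ck: "c k \<noteq> 0"
      \<comment> \<open>Solving the relation for \<open>x\<close> puts it into the excluded span
        \<open>?C\<close>.\<close>
      define r where "r = (of_rat (c k) * x + ?s) / of_rat (c k)"
      define c' where "c' i = - c i / c k" for i
      have "x = r + (\<Sum>i\<in>I. of_rat (c' i) * \<alpha> i)"
        using ck
        by (simp add: r_def c'_def of_rat_minus of_rat_divide sum_negf add_divide_distrib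
            flip: sum_divide_distrib)
      moreover have "r \<in> \<rat>" unfolding r_def using eq by (intro Rats_divide) auto
      ultimately have "x \<in> ?C"
        by (intro image_eqI[where x = "(r, \<Sum>i\<in>I. of_rat (c' i) * \<alpha> i)"]) auto
      with x show False by blast
    qed
    moreover have "\<forall>i\<in>I. c i = 0" using \<alpha>[of c] eq \<open>c k = 0\<close> by simp
    ultimately show ?thesis by simp
  qed
  then show ?case by blast
qed simp


section \<open>Liberating the action\<close>

lemma int_matrix_scale: "(A :: int ^ 'n ^ 'm) *v (c *s x) = c *s (A *v x)"
  by (simp add: vec_eq_iff matrix_vector_mult_def sum_distrib_left mult.left_commute)

lemma subspace_Fix: "int_vec.subspace (Fix U)"
  by (auto simp: int_vec.subspace_def Fix_def matrix_vector_right_distrib int_matrix_scale)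

text \<open>Composition twists the inner translation by \<open>U l\<close>; since \<open>U l\<close>
  fixes every \<open>v m\<close>, translations simply add, as \<open>v\<close> does.\<close>

lemma translation_affine_action:
  fixes U :: "int ^ 'p \<Rightarrow> int ^ 'q ^ 'q"
  assumes U: "linear_action U"
    and add: "\<And>l m. v (l + m) = v l + v m"
    and fixed: "\<And>l m. map_matrix real_of_int (U l) *v v m = v m"
  shows "affine_action (\<lambda>l. torus_affine (U l) (abs_torus (v l)))"
    and "induced_action (\<lambda>l. torus_affine (U l) (abs_torus (v l))) = U"
proof -
  have mult: "U (l + m) = U l ** U m" and inv: "invertible (U l)" for l m
    using U by (auto simp: linear_action_def hom_def lattice_group_def GL_int_def)
  have "torus_linear (U l) (abs_torus (v m)) + abs_torus (v l) = abs_torus (v (l + m))" for l m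
    by (simp add: torus_linear.abs_eq plus_torus.abs_eq fixed add add.commute)
  then show "affine_action (\<lambda>l. torus_affine (U l) (abs_torus (v l)))"
    using inv
    by (auto simp: affine_action_def hom_def lattice_group_def affine_group_def
        torus_affine_comp mult)
  show "induced_action (\<lambda>l. torus_affine (U l) (abs_torus (v l))) = U"
    by (simp add: induced_action_def linear_part_torus_affine)
qed

text \<open>A fixed point lifts to \<open>y\<close> with \<open>(A - 1) y + w\<close> integral.
  Pairing with \<open>c\<close> kills the first summand and leaves a rational value at
  \<open>w\<close>.\<close>

lemma no_fixed_point:
  fixes A :: "int ^ 'q ^ 'q" and c :: "rat ^ 'q"
  assumes c: "\<And>j. (\<Sum>i\<in>UNIV. c $ i * of_int ((A - mat 1) $ i $ j)) = 0"
    and irr: "(\<Sum>i\<in>UNIV. of_rat (c $ i) * w $ i) \<notin> \<rat>"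
  shows "torus_affine A (abs_torus w) x \<noteq> x"
proof
  assume fp: "torus_affine A (abs_torus w) x = x"
  obtain y where x: "x = abs_torus y" by (metis Quotient3_abs_rep[OF Quotient3_torus])
  let ?z = "map_matrix real_of_int A *v y + w - y"
  have z: "?z $ i \<in> \<int>" for i
    using fp by (simp add: x torus_affine_def torus_linear.abs_eq plus_torus.abs_eq
        torus.abs_eq_iff torus_rel_def)
  have N: "(map_matrix real_of_int A *v y - y) $ i
      = (\<Sum>j\<in>UNIV. of_int ((A - mat 1) $ i $ j) * y $ j)" for i
    by (simp add: matrix_vector_mult_def mat_def left_diff_distrib sum_subtractf mult_delta_left
        if_distrib[of real_of_int] cong: if_cong)
  have "(\<Sum>i\<in>UNIV. of_rat (c $ i) * (map_matrix real_of_int A *v y - y) $ i)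
      = (\<Sum>j\<in>UNIV. (\<Sum>i\<in>UNIV. of_rat (c $ i) * of_int ((A - mat 1) $ i $ j)) * y $ j)"
    unfolding N sum_distrib_left sum_distrib_right by (subst sum.swap) (simp only: mult.assoc)
  \<comment> \<open>Pulling \<open>of_rat\<close> out lets the hypothesis over the rationals act on
    the real vector \<open>y\<close>.\<close>
  also have "\<dots> = (\<Sum>j\<in>UNIV. of_rat (\<Sum>i\<in>UNIV. c $ i * of_int ((A - mat 1) $ i $ j)) * y $ j)"
    by (simp only: of_rat_sum of_rat_mult of_rat_of_int_eq)
  also have "\<dots> = 0" unfolding c by simp
  finally have "(\<Sum>i\<in>UNIV. of_rat (c $ i) * w $ i) = (\<Sum>i\<in>UNIV. of_rat (c $ i) * ?z $ i)"
    by (simp add: algebra_simps sum.distrib sum_subtractf)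
  also have "\<dots> \<in> \<rat>" using z Ints_subset_Rats by (intro Rats_sum Rats_mult) auto
  finally show False using irr by simp
qed

theorem corollary4p2:
  fixes U :: "int ^ 'p \<Rightarrow> int ^ 'q ^ 'q"
  assumes "unipotent_action U"
    and "2 * free_rank (Fix U) > CARD('q)"
  shows "liberated_affine U"
proof -
  have U: "linear_action U" using assms(1) by (simp add: unipotent_action_def)
  obtain B where B: "int_vec.independent B" "int_vec.span B = Fix U" "card B = free_rank (Fix U)"
    using free_rank_basis[OF subspace_Fix] .
  have card: "CARD('q) < 2 * card B" using assms(2) B(3) by simp
  have fin: "finite B" using card by (auto intro: card_ge_0_finite)
  have fixed: "U l *v b = b" if "b \<in> B" for b l
    using that B(2) int_vec.span_base by (fastforce simp: Fix_def)
  \<comment> \<open>One real for each pair of a generator of the acting group and a basis vector of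
    \<open>Fix U\<close>. The family is fixed before \<open>l\<close>, whereas the functional
    \<open>c\<close> below may depend on \<open>l\<close>.\<close>
  obtain \<alpha> :: "'p \<times> (int ^ 'q) \<Rightarrow> real" where \<alpha>:
    "\<And>c. (\<Sum>k\<in>UNIV \<times> B. of_rat (c k) * \<alpha> k) \<in> \<rat> \<Longrightarrow> \<forall>k\<in>UNIV \<times> B. c k = 0"
    using rationally_independent_family[OF finite_cartesian_product[OF finite_class.finite_UNIV fin]]
    by blast
  define v :: "int ^ 'p \<Rightarrow> real ^ 'q" where
    "v l = (\<Sum>(j, b)\<in>UNIV \<times> B. (of_int (l $ j) * \<alpha> (j, b)) *s of_int_vec b)" for l
  have add: "v (l + m) = v l + v m" for l m
    unfolding v_def sum.distrib[symmetric]
    by (intro sum.cong) (auto simp: vec_eq_iff algebra_simps)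
  have vfix: "map_matrix real_of_int (U l) *v v m = v m" for l m
    unfolding v_def vec.sum
    by (intro sum.cong) (auto simp: vector_scalar_commute of_int_vec_mult fixed)
  have free: "torus_affine (U l) (abs_torus (v l)) x \<noteq> x" if l: "l \<noteq> 0" for l x
  proof -
    have ker: "(U l - mat 1) *v b = 0" if "b \<in> B" for b
      using fixed[OF that] by (simp add: matrix_vector_mult_diff_rdistrib)
    obtain c :: "rat ^ 'q" where c: "\<And>j. (\<Sum>i\<in>UNIV. c $ i * of_int ((U l - mat 1) $ i $ j)) = 0"
      and cb: "\<exists>b\<in>B. (\<Sum>i\<in>UNIV. c $ i * of_int (b $ i)) \<noteq> 0"
      using rational_functional[OF B(1) ker card] by blast
    show ?thesis
    proof (rule no_fixed_point[OF c])
      \<comment> \<open>\<open>?h (j, b)\<close> is the rational coefficient of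
        \<open>\<alpha> (j, b)\<close> in the pairing of \<open>c\<close> with
        \<open>v l\<close>.\<close>
      let ?h = "\<lambda>(j, b). of_int (l $ j) * (\<Sum>i\<in>UNIV. c $ i * of_int (b $ i))"
      have "(\<Sum>i\<in>UNIV. of_rat (c $ i) * v l $ i)
          = (\<Sum>k\<in>UNIV \<times> B. \<Sum>i\<in>UNIV. of_rat (c $ i) *
              (of_int (l $ fst k) * \<alpha> k * of_int (snd k $ i)))"
        unfolding v_def
        by (subst sum.swap) (simp add: sum_distrib_left case_prod_beta)
      also have "\<dots> = (\<Sum>k\<in>UNIV \<times> B. of_rat (?h k) * \<alpha> k)"
        by (intro sum.cong refl)
          (auto simp: of_rat_mult of_rat_sum sum_distrib_left sum_distrib_right mult_ac)
      finally have eq: "(\<Sum>i\<in>UNIV. of_rat (c $ i) * v l $ i) = (\<Sum>k\<in>UNIV \<times> B. of_rat (?h k) * \<alpha> k)" .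
      show "(\<Sum>i\<in>UNIV. of_rat (c $ i) * v l $ i) \<notin> \<rat>"
      proof
        assume "(\<Sum>i\<in>UNIV. of_rat (c $ i) * v l $ i) \<in> \<rat>"
        then have "\<forall>k\<in>UNIV \<times> B. ?h k = 0" unfolding eq by (rule \<alpha>)
        \<comment> \<open>With this \<open>j\<close> and a \<open>b\<close> on which
          \<open>c\<close> does not vanish, \<open>?h (j, b)\<close> is a product of nonzero
          factors.\<close>
        moreover obtain j where "l $ j \<noteq> 0" using l by (auto simp: vec_eq_iff)
        ultimately show False using cb by auto
      qed
    qed
  qed
  show ?thesis
    unfolding liberated_affine_def free_action_def
    using translation_affine_action[OF U add vfix] free by blast
qed

end
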